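(* Let $\vec S$ be a finite separation system which is submodular. Then there exist a finite universe of separations $\vec U$ and an embedding $\varphi\colon \vec S\to\vec U$ of separation systems such that the image $\varphi(\vec S)$ is submodular in $\vec U$.
   Context: A separation system is a partially ordered set $\vec S$ with an order-reversing involution ${}^*$. It is called submodular if any two $r,s\in\vec S$ have a supremum or an infimum (or both) in the poset $\vec S$. A universe of separations is a separation system $\vec U$ whose poset is a lattice (a non-empty poset in which any two elements $a,b$ have a supremum $a\vee b$ and an infimum $a\wedge b$). A subsystem of a separation system is a subset closed under its involution, with the restricted order and involution. A subsystem $\vec T$ of a universe $\vec U$ is submodular in $\vec U$ if for all $r,s\in\vec T$ at least one of $r\vee s$ and $r\wedge s$ (taken in $\vec U$) lies in $\vec T$. An embedding $\varphi\colon\vec S\to\vec U$ of separation systems is an injective map with $r\le s\Leftrightarrow\varphi(r)\le\varphi(s)$ and $\varphi(s^* )=\varphi(s)^*$ for all $r,s\in\vec S$, i.e. an isomorphism of separation systems onto its image. *)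

theory Defs
  imports "HOL-Algebra.Lattice"
begin

record 'a sep_system = "'a gorder" +
  star :: "'a \<Rightarrow> 'a"

locale sep_system = partial_order S for S (structure) +
  assumes star_closed: "r \<in> carrier S \<Longrightarrow> star S r \<in> carrier S"
    and star_involutive: "r \<in> carrier S \<Longrightarrow> star S (star S r) = r"
    and star_antimono:
      "\<lbrakk>r \<in> carrier S; s \<in> carrier S; r \<sqsubseteq> s\<rbrakk> \<Longrightarrow> star S s \<sqsubseteq> star S r"

definition submodular :: "('a, 'b) sep_system_scheme \<Rightarrow> bool" where
  "submodular S \<longleftrightarrow>
    (\<forall>r \<in> carrier S. \<forall>s \<in> carrier S.
      (\<exists>x. least S x (Upper S {r, s})) \<or> (\<exists>x. greatest S x (Lower S {r, s})))"

text \<open>Non-emptiness is required explicitly, because the locale \<^locale>\<open>lattice\<close> also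
  admits the empty carrier.\<close>

locale sep_universe = sep_system U + lattice U for U (structure) +
  assumes carrier_nonempty: "carrier U \<noteq> {}"

definition subsystem :: "'a set \<Rightarrow> ('a, 'b) sep_system_scheme \<Rightarrow> bool" where
  "subsystem T S \<longleftrightarrow> T \<subseteq> carrier S \<and> (\<forall>t \<in> T. star S t \<in> T)"

definition submodular_in :: "'a set \<Rightarrow> ('a, 'b) sep_system_scheme \<Rightarrow> bool" where
  "submodular_in T U \<longleftrightarrow> subsystem T U \<and>
    (\<forall>r \<in> T. \<forall>s \<in> T. r \<squnion>\<^bsub>U\<^esub> s \<in> T \<or> r \<sqinter>\<^bsub>U\<^esub> s \<in> T)"

definition sep_embedding ::
    "('a, 'c) sep_system_scheme \<Rightarrow> ('b, 'd) sep_system_scheme \<Rightarrow> ('a \<Rightarrow> 'b) \<Rightarrow> bool" where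
  "sep_embedding S U \<phi> \<longleftrightarrow>
    \<phi> \<in> carrier S \<rightarrow> carrier U \<and>
    inj_on \<phi> (carrier S) \<and>
    (\<forall>r \<in> carrier S. \<forall>s \<in> carrier S. r \<sqsubseteq>\<^bsub>S\<^esub> s \<longleftrightarrow> \<phi> r \<sqsubseteq>\<^bsub>U\<^esub> \<phi> s) \<and>
    (\<forall>s \<in> carrier S. \<phi> (star S s) = star U (\<phi> s))"

text \<open>An existence claim for a finite universe cannot quantify over its type of elements.
  Every finite universe is isomorphic to one whose carrier is a finite set of natural numbers,
  so it can be stated, without loss of generality, for universes over \<^typ>\<open>nat\<close>.\<close>

end

theory Submission
  imports Defs
begin

text \<open>The universe is the Dedekind--MacNeille completion of \<open>S\<close>, whose elements are the sets \<open>A\<close>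
  of separations equal to the set of lower bounds of their upper bounds. The completion preserves
  every supremum and infimum that exists in \<open>S\<close>, so submodularity of \<open>S\<close> becomes submodularity
  of its image; and the involution extends to it by exchanging the two sides of a cut,
  \<open>A \<mapsto> {b\<^sup>* | b \<in> Upper S A}\<close>.\<close>

section \<open>Suprema and infima of pairs\<close>

lemma least_Upper_pair_iff:
  assumes "a \<in> carrier L" "b \<in> carrier L"
  shows "least L x (Upper L {a, b}) \<longleftrightarrow>
    x \<in> carrier L \<and> a \<sqsubseteq>\<^bsub>L\<^esub> x \<and> b \<sqsubseteq>\<^bsub>L\<^esub> x \<and>
    (\<forall>y \<in> carrier L. a \<sqsubseteq>\<^bsub>L\<^esub> y \<longrightarrow> b \<sqsubseteq>\<^bsub>L\<^esub> y \<longrightarrow> x \<sqsubseteq>\<^bsub>L\<^esub> y)"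
  using assms by (auto simp: least_def Upper_def)

lemma greatest_Lower_pair_iff:
  assumes "a \<in> carrier L" "b \<in> carrier L"
  shows "greatest L x (Lower L {a, b}) \<longleftrightarrow>
    x \<in> carrier L \<and> x \<sqsubseteq>\<^bsub>L\<^esub> a \<and> x \<sqsubseteq>\<^bsub>L\<^esub> b \<and>
    (\<forall>y \<in> carrier L. y \<sqsubseteq>\<^bsub>L\<^esub> a \<longrightarrow> y \<sqsubseteq>\<^bsub>L\<^esub> b \<longrightarrow> y \<sqsubseteq>\<^bsub>L\<^esub> x)"
  using assms by (auto simp: greatest_def Lower_def)

lemma (in partial_order) join_eqI:
  assumes "least L x (Upper L {a, b})"
  shows "a \<squnion> b = x"
  unfolding join_def sup_def
proof (rule some_equality)
  show "y = x" if "least L y (Upper L {a, b})" for y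
    using that assms by (rule least_unique)
qed (rule assms)

lemma (in partial_order) meet_eqI:
  assumes "greatest L x (Lower L {a, b})"
  shows "a \<sqinter> b = x"
  unfolding meet_def inf_def
proof (rule some_equality)
  show "y = x" if "greatest L y (Lower L {a, b})" for y
    using that assms by (rule greatest_unique)
qed (rule assms)

section \<open>Cuts as the closed sets of the Galois connection between \<open>Upper\<close> and
  \<open>Lower\<close>\<close>

definition cuts :: "('a, 'b) gorder_scheme \<Rightarrow> 'a set set" where
  "cuts S = {A. A \<subseteq> carrier S \<and> Lower S (Upper S A) = A}"

definition cut_star :: "('a, 'b) sep_system_scheme \<Rightarrow> 'a set \<Rightarrow> 'a set" where
  "cut_star S A = star S ` Upper S A"

lemma finite_cuts: "finite (carrier S) \<Longrightarrow> finite (cuts S)"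
  by (rule finite_subset[of _ "Pow (carrier S)"]) (auto simp: cuts_def)

lemma cuts_closed: "A \<in> cuts S \<Longrightarrow> A \<subseteq> carrier S"
  by (simp add: cuts_def)

lemma subset_Lower_Upper: "A \<subseteq> carrier S \<Longrightarrow> A \<subseteq> Lower S (Upper S A)"
  by (auto simp: Lower_def Upper_def)

lemma subset_Upper_Lower: "A \<subseteq> carrier S \<Longrightarrow> A \<subseteq> Upper S (Lower S A)"
  by (auto simp: Lower_def Upper_def)

text \<open>The Galois identity Lower-Upper-Lower = Lower. It is the source of all the cuts built
  below other than intersections: principal cuts, joins, images under \<open>cut_star\<close> and
  the top.\<close>

lemma Lower_in_cuts: "A \<subseteq> carrier S \<Longrightarrow> Lower S A \<in> cuts S"
  using subset_Upper_Lower[of A S] by (auto simp: cuts_def Lower_def Upper_def)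

lemma Lower_Upper_least_cut:
  assumes "C \<in> cuts S" "A \<subseteq> C"
  shows "Lower S (Upper S A) \<subseteq> C"
proof -
  have "Lower S (Upper S A) \<subseteq> Lower S (Upper S C)"
    using assms(2) by (intro Lower_antimono Upper_antimono) auto
  then show ?thesis
    using assms(1) by (simp add: cuts_def)
qed

text \<open>Closed sets of a closure operator are stable under intersection: the closure of
  \<open>A \<inter> B\<close> lies in \<open>A\<close> and in \<open>B\<close>.\<close>

lemma cuts_Int:
  assumes "A \<in> cuts S" "B \<in> cuts S"
  shows "A \<inter> B \<in> cuts S"
  using subset_Lower_Upper[of "A \<inter> B" S] Lower_Upper_least_cut[of A S "A \<inter> B"]
    Lower_Upper_least_cut[of B S "A \<inter> B"] assms
  by (auto simp: cuts_def)

section \<open>Principal cuts\<close>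

context partial_order
begin

text \<open>Cuts are down-sets: what lies below \<open>r\<close> lies below every upper bound of a
  cut containing \<open>r\<close>. Comparing a principal cut with a cut thus becomes a membership
  test.\<close>

lemma Lower_singleton_subset_cut_iff:
  assumes "C \<in> cuts L" "r \<in> carrier L"
  shows "Lower L {r} \<subseteq> C \<longleftrightarrow> r \<in> C"
proof
  assume "Lower L {r} \<subseteq> C"
  then show "r \<in> C"
    using assms by (auto simp: Lower_def)
next
  assume "r \<in> C"
  have "x \<sqsubseteq> u" if "x \<in> Lower L {r}" "u \<in> Upper L C" for x u
    using that \<open>r \<in> C\<close> assms le_trans[of x r u] by (simp add: Lower_def Upper_def)
  then have "Lower L {r} \<subseteq> Lower L (Upper L C)"
    by (auto simp: Lower_def)
  then show "Lower L {r} \<subseteq> C"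
    using assms by (simp add: cuts_def)
qed

lemma Lower_singleton_subset_iff:
  assumes "r \<in> carrier L" "s \<in> carrier L"
  shows "Lower L {r} \<subseteq> Lower L {s} \<longleftrightarrow> r \<sqsubseteq> s"
  using assms by (auto simp: Lower_singleton_subset_cut_iff Lower_in_cuts) (auto simp: Lower_def)

lemma Upper_Lower_singleton:
  assumes "s \<in> carrier L"
  shows "Upper L (Lower L {s}) = Upper L {s}"
proof
  show "Upper L (Lower L {s}) \<subseteq> Upper L {s}"
    using assms by (intro Upper_antimono) (simp add: Lower_def)
  have "x \<sqsubseteq> u" if "x \<in> Lower L {s}" "u \<in> Upper L {s}" for x u
    using that assms le_trans[of x s u] by (simp add: Lower_def Upper_def)
  then show "Upper L {s} \<subseteq> Upper L (Lower L {s})"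
    by (auto simp: Upper_def)
qed

end

section \<open>The involution on cuts\<close>

context sep_system
begin

lemma star_le_iff:
  assumes "r \<in> carrier S" "s \<in> carrier S"
  shows "star S r \<sqsubseteq> star S s \<longleftrightarrow> s \<sqsubseteq> r"
  using star_antimono[of "star S r" "star S s"] star_antimono[of s r] assms
  by (auto simp: star_closed star_involutive)

lemma star_image_star:
  assumes "A \<subseteq> carrier S"
  shows "star S ` star S ` A = A"
proof -
  have "star S ` star S ` A = (\<lambda>a. a) ` A"
    unfolding image_image using assms by (intro image_cong) (auto simp: star_involutive)
  then show ?thesis by simp
qed

text \<open>An order-reversing bijection exchanges upper and lower bounds. This turns
  \<open>cut_star S A\<close> into a set of lower bounds, hence into a cut.\<close>

lemma star_image_Upper:
  assumes "A \<subseteq> carrier S"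
  shows "star S ` Upper S A = Lower S (star S ` A)"
proof (intro equalityI subsetI)
  fix x assume "x \<in> star S ` Upper S A"
  then show "x \<in> Lower S (star S ` A)"
    using assms by (auto simp: Upper_def Lower_def star_closed star_le_iff)
next
  fix x assume x: "x \<in> Lower S (star S ` A)"
  then have xS: "x \<in> carrier S" by (simp add: Lower_def)
  have "a \<sqsubseteq> star S x" if "a \<in> A" for a
    using x that assms star_le_iff[of "star S x" a] xS
    by (auto simp: Lower_def star_closed star_involutive)
  then have "star S x \<in> Upper S A"
    using xS by (auto simp: Upper_def star_closed)
  then show "x \<in> star S ` Upper S A"
    using xS by (metis image_eqI star_involutive)
qed

lemma star_image_Lower:
  assumes "A \<subseteq> carrier S"
  shows "star S ` Lower S A = Upper S (star S ` A)"
proof -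
  have sub: "star S ` A \<subseteq> carrier S"
    using assms star_closed by auto
  have "star S ` Lower S A = star S ` star S ` Upper S (star S ` A)"
    using star_image_Upper[OF sub] star_image_star[OF assms] by simp
  then show ?thesis
    by (simp add: star_image_star)
qed

lemma cut_star_in_cuts:
  assumes "A \<in> cuts S"
  shows "cut_star S A \<in> cuts S"
  unfolding cut_star_def star_image_Upper[OF cuts_closed[OF assms]]
  using cuts_closed[OF assms] by (intro Lower_in_cuts) (auto simp: star_closed)

lemma cut_star_involutive:
  assumes "A \<in> cuts S"
  shows "cut_star S (cut_star S A) = A"
proof -
  have "cut_star S (cut_star S A) = star S ` star S ` Lower S (Upper S A)"
    by (simp add: cut_star_def star_image_Lower)
  also have "\<dots> = A"
    using assms by (simp add: cuts_def star_image_star)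
  finally show ?thesis .
qed

lemma cut_star_antimono: "A \<subseteq> B \<Longrightarrow> cut_star S B \<subseteq> cut_star S A"
  unfolding cut_star_def by (intro image_mono Upper_antimono)

lemma cut_star_Lower_singleton:
  assumes "s \<in> carrier S"
  shows "cut_star S (Lower S {s}) = Lower S {star S s}"
  using star_image_Upper[of "{s}"] assms by (simp add: cut_star_def Upper_Lower_singleton)

end

text \<open>The index set \<open>I\<close> allows the completion to live on any type large enough to enumerate the
  cuts.\<close>

locale indexed_cuts = sep_system S for S (structure) +
  fixes I :: "'i set" and cut :: "'i \<Rightarrow> 'a set"
  assumes cut_bij: "bij_betw cut I (cuts S)"
begin

abbreviation index :: "'a set \<Rightarrow> 'i" where
  "index \<equiv> inv_into I cut"

definition completion :: "'i sep_system" where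
  "completion = \<lparr>carrier = I, eq = (=), le = (\<lambda>i j. cut i \<subseteq> cut j),
    star = (\<lambda>i. index (cut_star S (cut i)))\<rparr>"

definition principal :: "'a \<Rightarrow> 'i" where
  "principal s = index (Lower S {s})"

lemma completion_simps [simp]:
  "carrier completion = I"
  "i .=\<^bsub>completion\<^esub> j \<longleftrightarrow> i = j"
  "i \<sqsubseteq>\<^bsub>completion\<^esub> j \<longleftrightarrow> cut i \<subseteq> cut j"
  "star completion i = index (cut_star S (cut i))"
  by (simp_all add: completion_def)

lemma cut_in_cuts [simp]: "i \<in> I \<Longrightarrow> cut i \<in> cuts S"
  using cut_bij by (auto simp: bij_betw_def)

lemma cut_index [simp]: "A \<in> cuts S \<Longrightarrow> cut (index A) = A"
  using cut_bij by (rule bij_betw_inv_into_right)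

lemma index_cut [simp]: "i \<in> I \<Longrightarrow> index (cut i) = i"
  using cut_bij by (rule bij_betw_inv_into_left)

lemma index_closed [simp]: "A \<in> cuts S \<Longrightarrow> index A \<in> I"
  using cut_bij by (simp add: bij_betw_def inv_into_into)

lemma cut_inject: "i \<in> I \<Longrightarrow> j \<in> I \<Longrightarrow> cut i = cut j \<longleftrightarrow> i = j"
  by (metis index_cut)

lemma sep_universe_completion: "sep_universe completion"
proof -
  have po: "partial_order completion"
    by unfold_locales (auto simp: cut_inject completion_def)
  interpret U: partial_order completion by (rule po)
  have sep: "sep_system completion"
    by unfold_locales
      (auto simp: cut_star_in_cuts cut_star_involutive intro: subsetD[OF cut_star_antimono])
  have join: "\<exists>k. least completion k (Upper completion {i, j})" if "i \<in> I" "j \<in> I" for i j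
  proof (intro exI)
    \<comment> \<open>A union of two cuts need not be a cut; the join is its closure, the least cut
      containing both.\<close>
    let ?C = "Lower S (Upper S (cut i \<union> cut j))"
    have "?C \<in> cuts S" by (simp add: Lower_in_cuts)
    moreover have "cut i \<union> cut j \<subseteq> ?C"
      using that by (intro subset_Lower_Upper) (simp add: cuts_closed)
    ultimately show "least completion (index ?C) (Upper completion {i, j})"
      using that by (simp add: least_Upper_pair_iff Lower_Upper_least_cut)
  qed
  have meet: "\<exists>k. greatest completion k (Lower completion {i, j})" if "i \<in> I" "j \<in> I" for i j
    using that
    by (intro exI[of _ "index (cut i \<inter> cut j)"]) (simp add: greatest_Lower_pair_iff cuts_Int)
  \<comment> \<open>\<open>Lower S {}\<close> is the whole carrier, the top cut; it exists even when
    \<open>S\<close> is empty.\<close>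
  have nonempty: "index (Lower S {}) \<in> I"
    by (intro index_closed Lower_in_cuts) simp
  interpret V: sep_system completion by (rule sep)
  show ?thesis
    by unfold_locales (use join meet nonempty in auto)
qed

section \<open>The embedding by principal cuts\<close>

lemma cut_principal [simp]: "s \<in> carrier S \<Longrightarrow> cut (principal s) = Lower S {s}"
  by (simp add: principal_def Lower_in_cuts)

lemma principal_closed [simp]: "s \<in> carrier S \<Longrightarrow> principal s \<in> I"
  by (simp add: principal_def Lower_in_cuts)

lemma principal_star:
  "s \<in> carrier S \<Longrightarrow> principal (star S s) = index (cut_star S (Lower S {s}))"
  by (simp add: principal_def cut_star_Lower_singleton)

lemma sep_embedding_principal: "sep_embedding S completion principal"
proof -
  have "inj_on principal (carrier S)"
  proof (rule inj_onI)
    fix r s assume rs: "r \<in> carrier S" "s \<in> carrier S" "principal r = principal s"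
    then have "Lower S {r} = Lower S {s}"
      by (metis cut_principal)
    then show "r = s"
      using rs by (metis Lower_singleton_subset_iff le_antisym order_refl)
  qed
  then show ?thesis
    by (auto simp: sep_embedding_def Lower_singleton_subset_iff principal_star)
qed

text \<open>If a cut \<open>C\<close> contains \<open>r\<close> and \<open>s\<close>, each upper
  bound of \<open>C\<close> is above both and hence above their supremum \<open>x\<close>. So
  \<open>x\<close> lies in the closure of \<open>C\<close>, which is \<open>C\<close>.\<close>

lemma principal_least:
  assumes "r \<in> carrier S" "s \<in> carrier S" "least S x (Upper S {r, s})"
  shows "least completion (principal x) (Upper completion {principal r, principal s})"
proof -
  have x: "x \<in> carrier S" "r \<sqsubseteq> x" "s \<sqsubseteq> x"
    and least: "\<And>y. y \<in> carrier S \<Longrightarrow> r \<sqsubseteq> y \<Longrightarrow> s \<sqsubseteq> y \<Longrightarrow> x \<sqsubseteq> y"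
    using assms by (auto simp: least_Upper_pair_iff)
  have "x \<in> C" if C: "C \<in> cuts S" "r \<in> C" "s \<in> C" for C
  proof -
    have "x \<in> Lower S (Upper S C)"
      using C x least assms by (auto simp: Lower_def Upper_def)
    then show ?thesis
      using C by (simp add: cuts_def)
  qed
  then show ?thesis
    using assms x
    by (simp add: least_Upper_pair_iff Lower_singleton_subset_iff Lower_singleton_subset_cut_iff)
qed

text \<open>An element below both \<open>r\<close> and \<open>s\<close> is below their infimum
  \<open>x\<close>, so a set inside both principal cuts is inside that of \<open>x\<close>.\<close>

lemma principal_greatest:
  assumes "r \<in> carrier S" "s \<in> carrier S" "greatest S x (Lower S {r, s})"
  shows "greatest completion (principal x) (Lower completion {principal r, principal s})"
proof -
  have x: "x \<in> carrier S" "x \<sqsubseteq> r" "x \<sqsubseteq> s"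
    and greatest: "\<And>y. y \<in> carrier S \<Longrightarrow> y \<sqsubseteq> r \<Longrightarrow> y \<sqsubseteq> s \<Longrightarrow> y \<sqsubseteq> x"
    using assms by (auto simp: greatest_Lower_pair_iff)
  have "C \<subseteq> Lower S {x}" if "C \<subseteq> Lower S {r}" "C \<subseteq> Lower S {s}" for C
    using that assms(1,2) greatest unfolding Lower_def by blast
  then show ?thesis
    using assms x by (simp add: greatest_Lower_pair_iff Lower_singleton_subset_iff)
qed

lemma submodular_in_principal:
  assumes "submodular S"
  shows "submodular_in (principal ` carrier S) completion"
proof -
  interpret U: sep_universe completion by (rule sep_universe_completion)
  have "principal r \<squnion>\<^bsub>completion\<^esub> principal s \<in> principal ` carrier S \<or>
      principal r \<sqinter>\<^bsub>completion\<^esub> principal s \<in> principal ` carrier S"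
    if rs: "r \<in> carrier S" "s \<in> carrier S" for r s
  proof -
    consider x where "least S x (Upper S {r, s})" | x where "greatest S x (Lower S {r, s})"
      using assms rs unfolding submodular_def by blast
    then show ?thesis
    proof cases
      case 1
      then have "principal r \<squnion>\<^bsub>completion\<^esub> principal s = principal x"
        using rs by (intro U.join_eqI principal_least)
      moreover have "x \<in> carrier S"
        using 1 rs by (simp add: least_Upper_pair_iff)
      ultimately show ?thesis by simp
    next
      case 2
      then have "principal r \<sqinter>\<^bsub>completion\<^esub> principal s = principal x"
        using rs by (intro U.meet_eqI principal_greatest)
      moreover have "x \<in> carrier S"
        using 2 rs by (simp add: greatest_Lower_pair_iff)
      ultimately show ?thesis by simp
    qed
  qed
  \<comment> \<open>Read from right to left, \<open>principal_star\<close> shows that the involution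
    sends the principal cut of \<open>s\<close> to that of \<open>star S s\<close>.\<close>
  moreover have "subsystem (principal ` carrier S) completion"
    by (auto simp: subsystem_def star_closed simp flip: principal_star)
  ultimately show ?thesis
    by (auto simp: submodular_in_def)
qed

end

theorem theorem1:
  fixes S :: "'a sep_system"
  assumes "sep_system S"
    and "finite (carrier S)"
    and "submodular S"
  shows "\<exists>(U :: nat sep_system) \<phi>.
    sep_universe U \<and> finite (carrier U) \<and>
    sep_embedding S U \<phi> \<and> submodular_in (\<phi> ` carrier S) U"
proof -
  \<comment> \<open>A finite carrier has finitely many cuts, so an initial segment of the naturals
    can index them; this puts the completion on \<open>nat\<close>.\<close>
  obtain cut :: "nat \<Rightarrow> 'a set" where cut: "bij_betw cut {0..<card (cuts S)} (cuts S)"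
    using ex_bij_betw_nat_finite[OF finite_cuts[OF assms(2)]] by blast
  interpret sep_system S by (rule assms(1))
  interpret indexed_cuts S "{0..<card (cuts S)}" cut
    by unfold_locales (rule cut)
  have "finite (carrier completion)" by simp
  with sep_universe_completion sep_embedding_principal submodular_in_principal[OF assms(3)]
  show ?thesis by blast
qed

end
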